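(* Let $H$ be a complex Hilbert space, let $T\in\mathcal{B}(H)$, let $T=V|T|$ be the polar decomposition of $T$, and suppose that $\ker(T)=\ker(T^* )$. Consider the following statements: (1) $T$ is semi-hyponormal; (2) $V|T|V^*\leq |T|\leq V^*|T|V$; (3) $\tilde{T}$ is semi-hyponormal; (4) $M(T)$ is semi-hyponormal; (5) $\Delta(T)$ is hyponormal; (6) $V|T|V^*\leq V^*|T|V$. Then $$(1)\iff(2)\iff(3)\implies(4)\iff(5)\iff(6).$$
   Context: $\mathcal{B}(H)$ is the algebra of bounded linear operators on $H$. For $T\in\mathcal{B}(H)$, $|T|=(T^*T)^{1/2}$, and the polar decomposition $T=V|T|$ is the canonical one: $V$ is the unique partial isometry with $T=V|T|$ and $\ker(V)=\ker(T)$. Associated with $T=V|T|$ are the Duggal transform $\tilde{T}=|T|V$, the mean transform $M(T)=\frac12(T+|T|V)$, and the Aluthge transform $\Delta(T)=|T|^{1/2}V|T|^{1/2}$. An operator $A\in\mathcal{B}(H)$ is hyponormal if $A^*A\geq AA^*$, and semi-hyponormal if $(A^*A)^{1/2}\geq (AA^* )^{1/2}$, i.e. $|A|\geq|A^*|$. Inequalities between self-adjoint operators are in the usual (positive semidefinite) order. *)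

theory Defs
  imports "HOL-Analysis.Analysis"
begin

text \<open>
  Complex Hilbert spaces are built on top of the library's real inner product spaces: the real
  structure is the underlying one, with real inner product \<open>Re \<langle>x, y\<rangle>\<close>. Hence the norm, being
  \<open>sqrt (inner x x)\<close>, is the Hilbert space norm, and \<open>cinner x x\<close> is real and positive for
  \<open>x \<noteq> 0\<close>. The complex inner product is linear in its first argument.
\<close>

class complex_inner = real_inner +
  fixes scaleC :: "complex \<Rightarrow> 'a \<Rightarrow> 'a"  (infixr "*\<^sub>C" 75)
    and cinner :: "'a \<Rightarrow> 'a \<Rightarrow> complex"
  assumes scaleC_add_right: "c *\<^sub>C (x + y) = c *\<^sub>C x + c *\<^sub>C y"
    and scaleC_add_left: "(c + d) *\<^sub>C x = c *\<^sub>C x + d *\<^sub>C x"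
    and scaleC_scaleC: "c *\<^sub>C (d *\<^sub>C x) = (c * d) *\<^sub>C x"
    and scaleR_scaleC: "r *\<^sub>R x = complex_of_real r *\<^sub>C x"
    and cinner_commute: "cinner x y = cnj (cinner y x)"
    and cinner_add_left: "cinner (x + y) z = cinner x z + cinner y z"
    and cinner_scaleC_left: "cinner (c *\<^sub>C x) y = c * cinner x y"
    and inner_eq_Re_cinner: "inner x y = Re (cinner x y)"

class chilbert_space = complex_inner + complete_space

instantiation complex :: chilbert_space
begin

definition scaleC_complex :: "complex \<Rightarrow> complex \<Rightarrow> complex"
  where "scaleC_complex c x = c * x"

definition cinner_complex :: "complex \<Rightarrow> complex \<Rightarrow> complex"
  where "cinner_complex x y = x * cnj y"

instance
  by standard
    (auto simp: scaleC_complex_def cinner_complex_def inner_complex_def scaleR_conv_of_real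
      algebra_simps)

end

definition bounded_clinear :: "('a::complex_inner \<Rightarrow> 'a) \<Rightarrow> bool"
  where "bounded_clinear T \<longleftrightarrow> bounded_linear T \<and> (\<forall>c x. T (c *\<^sub>C x) = c *\<^sub>C T x)"

abbreviation ker :: "('a::complex_inner \<Rightarrow> 'a) \<Rightarrow> 'a set"
  where "ker T \<equiv> {x. T x = 0}"

definition adj :: "('a::chilbert_space \<Rightarrow> 'a) \<Rightarrow> 'a \<Rightarrow> 'a"
  where "adj T = (THE S. \<forall>x y. cinner (T x) y = cinner x (S y))"

definition positive_op :: "('a::complex_inner \<Rightarrow> 'a) \<Rightarrow> bool"
  where "positive_op A \<longleftrightarrow> bounded_clinear A \<and> (\<forall>x. cinner (A x) x \<in> \<real>\<^sub>\<ge>\<^sub>0)"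

definition op_le :: "('a::complex_inner \<Rightarrow> 'a) \<Rightarrow> ('a \<Rightarrow> 'a) \<Rightarrow> bool"  (infix "\<preceq>" 50)
  where "A \<preceq> B \<longleftrightarrow> positive_op (\<lambda>x. B x - A x)"

text \<open>The positive square root; meaningful for positive \<open>A\<close>, where it exists and is unique.\<close>

definition sqrt_op :: "('a::chilbert_space \<Rightarrow> 'a) \<Rightarrow> 'a \<Rightarrow> 'a"
  where "sqrt_op A = (THE S. positive_op S \<and> S \<circ> S = A)"

definition abs_op :: "('a::chilbert_space \<Rightarrow> 'a) \<Rightarrow> 'a \<Rightarrow> 'a"
  where "abs_op T = sqrt_op (adj T \<circ> T)"

definition partial_isometry :: "('a::chilbert_space \<Rightarrow> 'a) \<Rightarrow> bool"
  where "partial_isometry V \<longleftrightarrow> bounded_clinear V \<and>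
    (\<forall>x. (\<forall>y\<in>ker V. cinner x y = 0) \<longrightarrow> norm (V x) = norm x)"

definition polar_decomposition :: "('a::chilbert_space \<Rightarrow> 'a) \<Rightarrow> ('a \<Rightarrow> 'a) \<Rightarrow> bool"
  where "polar_decomposition T V \<longleftrightarrow>
    partial_isometry V \<and> T = V \<circ> abs_op T \<and> ker V = ker T"

definition polar_part :: "('a::chilbert_space \<Rightarrow> 'a) \<Rightarrow> 'a \<Rightarrow> 'a"
  where "polar_part T = (THE V. polar_decomposition T V)"

definition duggal_transform :: "('a::chilbert_space \<Rightarrow> 'a) \<Rightarrow> 'a \<Rightarrow> 'a"
  where "duggal_transform T = abs_op T \<circ> polar_part T"

definition mean_transform :: "('a::chilbert_space \<Rightarrow> 'a) \<Rightarrow> 'a \<Rightarrow> 'a"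
  where "mean_transform T = (\<lambda>x. (1/2) *\<^sub>C (T x + abs_op T (polar_part T x)))"

definition aluthge_transform :: "('a::chilbert_space \<Rightarrow> 'a) \<Rightarrow> 'a \<Rightarrow> 'a"
  where "aluthge_transform T =
    sqrt_op (abs_op T) \<circ> polar_part T \<circ> sqrt_op (abs_op T)"

definition hyponormal :: "('a::chilbert_space \<Rightarrow> 'a) \<Rightarrow> bool"
  where "hyponormal A \<longleftrightarrow> A \<circ> adj A \<preceq> adj A \<circ> A"

definition semi_hyponormal :: "('a::chilbert_space \<Rightarrow> 'a) \<Rightarrow> bool"
  where "semi_hyponormal A \<longleftrightarrow> sqrt_op (A \<circ> adj A) \<preceq> sqrt_op (adj A \<circ> A)"

end

theory Submission
  imports Defs
begin

text \<open>
  Write \<open>P = |T|\<close>, \<open>L = V P V*\<close> and \<open>U = V* P V\<close>. The hypothesis \<open>ker T = ker T*\<close> says that \<open>V\<close> is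
  unitary on the orthogonal complement of \<open>ker T\<close> and zero on \<open>ker T\<close>; concretely, \<open>V* V P = P\<close> and
  \<open>V V* P = P\<close> (\<open>polar_decomposition_initial_projection\<close> and
  \<open>polar_decomposition_final_projection\<close>, after taking adjoints). All six statements then become
  inequalities between \<open>L\<close>, \<open>P\<close> and \<open>U\<close>.

  If \<open>A\<close> is positive and \<open>V* V A = A\<close>, then \<open>|V A| = A\<close> and \<open>|(V A)*| = V A V*\<close>, so \<open>V A\<close> is
  semi-hyponormal exactly when \<open>V A V* \<le> A\<close> (\<open>semi_hyponormal_compose_positive\<close>). This applies to
  \<open>T = V P\<close>, to the Duggal transform \<open>P V = V U\<close> and to the mean transform \<open>V (P + U) / 2\<close>. Since
  \<open>V U V* = P\<close>, the resulting conditions are \<open>L \<le> P\<close>, \<open>P \<le> U\<close> and \<open>(L + P) / 2 \<le> (P + U) / 2\<close>, the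
  last one being \<open>L \<le> U\<close>. The first two are conjugate to each other by \<open>V\<close>, and together they give
  the third by transitivity.

  For the Aluthge transform \<open>R V R\<close>, with \<open>R\<close> the square root of \<open>P\<close>, the self-commutator is
  \<open>R (U - L) R\<close>. Its positivity is equivalent to that of \<open>U - L\<close>, because \<open>U - L\<close> vanishes on the
  kernel of \<open>R\<close> and the range of \<open>R\<close> is dense in the complement of that kernel
  (\<open>positive_op_compression_iff\<close>).

  The moduli, adjoints and polar factors in these arguments are definite descriptions, so their
  existence and uniqueness carry weight: adjoints exist by the Riesz representation theorem, positive
  square roots exist by a norm-convergent iteration (\<open>positive_contraction_sqrt\<close>) and are unique
  (\<open>positive_sqrt_unique\<close>), and the polar factor is unique (\<open>polar_part_eq\<close>).
\<close>

section \<open>Orthogonal projections and the Riesz representation theorem\<close>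

instance chilbert_space \<subseteq> banach ..

lemma subspace_closure:
  fixes N :: "'a::real_normed_vector set"
  assumes "subspace N"
  shows "subspace (closure N)"
proof (rule subspaceI)
  show "0 \<in> closure N"
    using assms closure_subset subspace_0 by blast
next
  fix x y assume "x \<in> closure N" "y \<in> closure N"
  then obtain f g where "\<forall>n. f n \<in> N" "f \<longlonglongrightarrow> x" "\<forall>n. g n \<in> N" "g \<longlonglongrightarrow> y"
    by (auto simp: closure_sequential)
  then have "\<forall>n. f n + g n \<in> N" "(\<lambda>n. f n + g n) \<longlonglongrightarrow> x + y"
    using assms by (auto intro: subspace_add tendsto_add)
  then show "x + y \<in> closure N"
    unfolding closure_sequential by (intro exI[of _ "\<lambda>n. f n + g n"]) blast
next
  fix c x assume "x \<in> closure N"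
  then obtain f where "\<forall>n. f n \<in> N" "f \<longlonglongrightarrow> x"
    by (auto simp: closure_sequential)
  then have "\<forall>n. c *\<^sub>R f n \<in> N" "(\<lambda>n. c *\<^sub>R f n) \<longlonglongrightarrow> c *\<^sub>R x"
    using assms by (auto intro: subspace_scale tendsto_scaleR)
  then show "c *\<^sub>R x \<in> closure N"
    unfolding closure_sequential by (intro exI[of _ "\<lambda>n. c *\<^sub>R f n"]) blast
qed

text \<open>
  A minimising sequence for the distance from \<open>x\<close> to \<open>N\<close> is Cauchy by the parallelogram law; its
  limit is a closest point of \<open>N\<close>, and the variational inequality at a closest point, applied in the
  directions \<open>y\<close> and \<open>-y\<close>, is orthogonality.
\<close>

lemma orthogonal_projection:
  fixes N :: "'a::{real_inner, banach} set"
  assumes "closed N" "subspace N"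
  obtains p where "p \<in> N" "\<And>y. y \<in> N \<Longrightarrow> inner (x - p) y = 0"
proof -
  define D where "D = (INF n\<in>N. (norm (x - n))\<^sup>2)"
  have ne: "N \<noteq> {}" using assms(2) subspace_0 by blast
  have bdd: "bdd_below ((\<lambda>n. (norm (x - n))\<^sup>2) ` N)"
    by (intro bdd_belowI[of _ 0]) auto
  have D_le: "D \<le> (norm (x - n))\<^sup>2" if "n \<in> N" for n
    unfolding D_def using bdd that by (rule cINF_lower)
  have "\<exists>n\<in>N. (norm (x - n))\<^sup>2 < D + inverse (real (Suc k))" for k
    using cINF_less_iff[OF ne bdd, of "D + inverse (real (Suc k))"] by (simp add: D_def)
  then obtain f where fN: "\<And>k. f k \<in> N"
    and f: "\<And>k. (norm (x - f k))\<^sup>2 < D + inverse (real (Suc k))"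
    by metis
  \<comment> \<open>The midpoint of \<open>f k\<close> and \<open>f l\<close> is also at distance at least \<open>sqrt D\<close> from \<open>x\<close>, so by the
    parallelogram law the two points are close to each other.\<close>
  have close: "(norm (f k - f l))\<^sup>2 \<le> 2 * inverse (real (Suc k)) + 2 * inverse (real (Suc l))" for k l
  proof -
    have "(1/2) *\<^sub>R (f k + f l) \<in> N"
      using assms(2) fN by (intro subspace_scale subspace_add)
    then have "4 * D \<le> 4 * (norm (x - (1/2) *\<^sub>R (f k + f l)))\<^sup>2"
      using D_le by simp
    also have "\<dots> = (norm (2 *\<^sub>R (x - (1/2) *\<^sub>R (f k + f l))))\<^sup>2"
      by (simp only: norm_scaleR power_mult_distrib) simp
    also have "2 *\<^sub>R (x - (1/2) *\<^sub>R (f k + f l)) = (x - f k) + (x - f l)"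
      by (simp add: algebra_simps scaleR_2)
    finally have "4 * D \<le> (norm ((x - f k) + (x - f l)))\<^sup>2" .
    moreover have "(norm (f k - f l))\<^sup>2 = 2 * (norm (x - f k))\<^sup>2 + 2 * (norm (x - f l))\<^sup>2
        - (norm ((x - f k) + (x - f l)))\<^sup>2"
      by (simp add: power2_norm_eq_inner inner_simps inner_commute)
    ultimately show ?thesis using f[of k] f[of l] by linarith
  qed
  have "Cauchy f"
  proof (rule CauchyI)
    fix e :: real assume "0 < e"
    then obtain M where M: "inverse (real (Suc M)) < e\<^sup>2 / 4"
      using reals_Archimedean[of "e\<^sup>2 / 4"] by auto
    have "norm (f k - f l) < e" if "k \<ge> M" "l \<ge> M" for k l
    proof -
      have "inverse (real (Suc k)) \<le> inverse (real (Suc M))"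
        "inverse (real (Suc l)) \<le> inverse (real (Suc M))"
        using that by (auto intro!: le_imp_inverse_le)
      then have "(norm (f k - f l))\<^sup>2 < e\<^sup>2" using close[of k l] M by linarith
      then show ?thesis using \<open>0 < e\<close> by (simp add: power_less_imp_less_base)
    qed
    then show "\<exists>M. \<forall>k\<ge>M. \<forall>l\<ge>M. norm (f k - f l) < e" by blast
  qed
  then obtain p where p: "f \<longlonglongrightarrow> p" using convergent_eq_Cauchy by blast
  then have pN: "p \<in> N" using assms(1) fN closed_sequentially by blast
  have "(norm (x - p))\<^sup>2 \<le> D"
  proof (rule LIMSEQ_le)
    show "(\<lambda>k. (norm (x - f k))\<^sup>2) \<longlonglongrightarrow> (norm (x - p))\<^sup>2" by (intro tendsto_intros p)
    show "(\<lambda>k. D + inverse (real (Suc k))) \<longlonglongrightarrow> D"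
      using tendsto_add[OF tendsto_const LIMSEQ_inverse_real_of_nat, of D] by simp
    show "\<exists>N. \<forall>k\<ge>N. (norm (x - f k))\<^sup>2 \<le> D + inverse (real (Suc k))"
      using f less_imp_le by blast
  qed
  then have closest: "\<forall>z\<in>N. dist x p \<le> dist x z"
    using D_le by (metis dist_norm norm_ge_zero order_trans power2_le_imp_le)
  have le: "inner (x - p) y \<le> 0" if "y \<in> N" for y
    using any_closest_point_dot[OF subspace_imp_convex[OF assms(2)] assms(1) pN _ closest, of "p + y"]
      subspace_add[OF assms(2) pN that] by simp
  have "inner (x - p) y = 0" if "y \<in> N" for y
    using le[OF that] le[OF subspace_neg[OF assms(2) that]] by simp
  with pN that show ?thesis by blast
qed

text \<open>
  A vector \<open>w\<close> orthogonal to the kernel of \<open>f\<close> with \<open>f w \<noteq> 0\<close> represents \<open>f\<close> up to a scalar,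
  since \<open>f w *\<^sub>R x - f x *\<^sub>R w\<close> lies in that kernel for every \<open>x\<close>.
\<close>

lemma Riesz_representation:
  fixes f :: "'a::{real_inner, banach} \<Rightarrow> real"
  assumes "bounded_linear f"
  obtains z where "\<And>x. f x = inner x z"
proof (cases "\<forall>x. f x = 0")
  case True
  then show ?thesis using that[of 0] by simp
next
  case False
  then obtain u where u: "f u \<noteq> 0" by blast
  interpret bounded_linear f by fact
  have "closed {x. f x = 0}"
    by (intro closed_Collect_eq continuous_intros continuous_on)
  moreover have "subspace {x. f x = 0}"
    by (auto intro!: subspaceI simp: add scaleR)
  ultimately obtain p where p: "f p = 0" "\<And>y. f y = 0 \<Longrightarrow> inner (u - p) y = 0"
    using orthogonal_projection[of "{x. f x = 0}" u] by auto
  define w where "w = u - p"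
  have fw: "f w \<noteq> 0" using u p by (simp add: w_def diff)
  then have "w \<noteq> 0" using zero by metis
  have "f x = inner x ((f w / (inner w w)) *\<^sub>R w)" for x
  proof -
    have "f (f w *\<^sub>R x - f x *\<^sub>R w) = 0" by (simp add: diff scaleR)
    then have "inner w (f w *\<^sub>R x - f x *\<^sub>R w) = 0" using p w_def by blast
    then have "f x * inner w w = f w * inner x w"
      by (simp add: inner_simps inner_commute)
    then show ?thesis using \<open>w \<noteq> 0\<close> by (simp add: field_simps)
  qed
  then show ?thesis using that by blast
qed

section \<open>Complex inner products and adjoints\<close>

text \<open>
  Multiplication by \<open>\<i>\<close> is skew-adjoint for the real inner product. With
  this the complex inner product is recovered from the real one, so that adjoints and positivity
  can be handled through the real inner product alone.
\<close>

lemma inner_scaleC_i: "inner (\<i> *\<^sub>C x) y = - inner x (\<i> *\<^sub>C y)" for x :: "'a::complex_inner"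
proof -
  have "cinner x (\<i> *\<^sub>C y) = cnj (\<i> * cinner y x)"
    by (metis cinner_commute cinner_scaleC_left)
  also have "\<dots> = - \<i> * cinner x y"
    by (simp add: cinner_commute[of x y])
  finally show ?thesis by (simp add: inner_eq_Re_cinner cinner_scaleC_left)
qed

lemma cinner_eq_inner: "cinner x y = Complex (inner x y) (inner x (\<i> *\<^sub>C y))"
  for x :: "'a::complex_inner"
  using inner_scaleC_i[of x y]
  by (simp add: complex_eq_iff inner_eq_Re_cinner cinner_scaleC_left)

lemma scaleC_eq_scaleR: "c *\<^sub>C x = Re c *\<^sub>R x + Im c *\<^sub>R (\<i> *\<^sub>C x)" for x :: "'a::complex_inner"
proof -
  have "c = complex_of_real (Re c) + complex_of_real (Im c) * \<i>"
    by (simp add: complex_eq_iff)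
  then have "c *\<^sub>C x = (complex_of_real (Re c) + complex_of_real (Im c) * \<i>) *\<^sub>C x" by simp
  then show ?thesis by (simp add: scaleC_add_left scaleR_scaleC scaleC_scaleC)
qed

lemma i_scaleC_i [simp]: "\<i> *\<^sub>C (\<i> *\<^sub>C x) = - x" for x :: "'a::complex_inner"
  using scaleR_scaleC[of "-1" x] by (simp add: scaleC_scaleC)

lemma norm_scaleC_i [simp]: "norm (\<i> *\<^sub>C x) = norm x" for x :: "'a::complex_inner"
  using inner_scaleC_i[of x "\<i> *\<^sub>C x"] by (simp add: norm_eq_sqrt_inner)

lemma bounded_linear_scaleC: "bounded_linear (\<lambda>x::'a::complex_inner. c *\<^sub>C x)"
proof -
  have "bounded_linear (\<lambda>x::'a. \<i> *\<^sub>C x)"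
    by (rule bounded_linear_intro[where K = 1])
      (auto simp: scaleC_add_right scaleR_scaleC scaleC_scaleC mult.commute)
  then have "bounded_linear (\<lambda>x::'a. Re c *\<^sub>R x + Im c *\<^sub>R (\<i> *\<^sub>C x))"
    by (intro bounded_linear_add bounded_linear_scaleR_right
        bounded_linear_compose[OF bounded_linear_scaleR_right])
  then show ?thesis by (subst scaleC_eq_scaleR)
qed

lemma bounded_clinearI:
  assumes "bounded_linear A" "\<And>x. A (\<i> *\<^sub>C x) = \<i> *\<^sub>C A x"
  shows "bounded_clinear A"
proof -
  interpret bounded_linear A by fact
  have "A (c *\<^sub>C x) = c *\<^sub>C A x" for c x
    by (subst (1 2) scaleC_eq_scaleR) (simp add: add scaleR assms(2))
  then show ?thesis using assms(1) by (simp add: bounded_clinear_def)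
qed

lemma bounded_clinearD:
  assumes "bounded_clinear A"
  shows "bounded_linear A" "A (c *\<^sub>C x) = c *\<^sub>C A x"
  using assms by (auto simp: bounded_clinear_def)

lemma bounded_clinear_compose:
  "bounded_clinear A \<Longrightarrow> bounded_clinear B \<Longrightarrow> bounded_clinear (A \<circ> B)"
  unfolding bounded_clinear_def comp_def by (auto intro: bounded_linear_compose)

lemma bounded_clinear_add:
  "bounded_clinear A \<Longrightarrow> bounded_clinear B \<Longrightarrow> bounded_clinear (\<lambda>x. A x + B x)"
  unfolding bounded_clinear_def by (auto intro: bounded_linear_add simp: scaleC_add_right)

lemma bounded_clinear_diff:
  assumes "bounded_clinear A" "bounded_clinear B"
  shows "bounded_clinear (\<lambda>x. A x - B x)"
proof (rule bounded_clinearI)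
  interpret i: bounded_linear "\<lambda>x::'a. \<i> *\<^sub>C x" by (rule bounded_linear_scaleC)
  show "A (\<i> *\<^sub>C x) - B (\<i> *\<^sub>C x) = \<i> *\<^sub>C (A x - B x)" for x
    using assms by (simp add: bounded_clinearD i.diff)
qed (use assms in \<open>auto simp: bounded_clinear_def intro: bounded_linear_sub\<close>)

lemma bounded_clinear_scaleC:
  "bounded_clinear A \<Longrightarrow> bounded_clinear (\<lambda>x. c *\<^sub>C A x)"
  unfolding bounded_clinear_def
  by (auto intro: bounded_linear_compose[OF bounded_linear_scaleC] simp: scaleC_scaleC mult.commute)

lemma cinner_adjointI:
  assumes "bounded_clinear A" "\<And>x y. inner (A x) y = inner x (B y)"
  shows "cinner (A x) y = cinner x (B y)"
proof -
  have "inner (A x) (\<i> *\<^sub>C y) = - inner (A (\<i> *\<^sub>C x)) y"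
    using assms(1) by (simp add: bounded_clinearD inner_scaleC_i)
  also have "\<dots> = inner x (\<i> *\<^sub>C B y)"
    by (simp add: assms(2) inner_scaleC_i)
  finally show ?thesis by (simp add: cinner_eq_inner assms(2))
qed

lemma cinner_adjointD:
  assumes "\<And>x y. cinner (A x) y = cinner x (B y)"
  shows "inner (A x) y = inner x (B y)"
  using assms by (simp add: inner_eq_Re_cinner)

lemma adj_eqI:
  assumes "bounded_clinear A" "\<And>x y. inner (A x) y = inner x (B y)"
  shows "adj A = B"
  unfolding adj_def
proof (rule the_equality)
  show "\<forall>x y. cinner (A x) y = cinner x (B y)" using cinner_adjointI assms by blast
next
  fix C assume "\<forall>x y. cinner (A x) y = cinner x (C y)"
  then have "inner x (C y) = inner x (B y)" for x y
    using cinner_adjointD[of A C x y] assms(2) by simp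
  then show "C = B" by (intro ext) (metis vector_eq_ldot)
qed

text \<open>
  Riesz representation of the functionals \<open>\<lambda>x. inner (A x) y\<close> supplies an adjoint for the real
  inner product; complex linearity of \<open>A\<close> makes it the adjoint for \<open>cinner\<close>.
\<close>

lemma inner_adj_right:
  assumes "bounded_clinear A"
  shows "inner (A x) y = inner x (adj A y)"
proof -
  have "\<exists>z. \<forall>x. inner (A x) y = inner x z" for y
  proof -
    have "bounded_linear (\<lambda>x. inner (A x) y)"
      using bounded_linear_compose[OF bounded_linear_inner_left] assms bounded_clinearD(1) by blast
    then show ?thesis by (rule Riesz_representation) blast
  qed
  then obtain B where "\<And>x y. inner (A x) y = inner x (B y)" by metis
  moreover from this have "adj A = B" using adj_eqI assms by blast
  ultimately show ?thesis by simp
qed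

lemma inner_adj_left: "bounded_clinear A \<Longrightarrow> inner (adj A x) y = inner x (A y)"
  by (metis inner_adj_right inner_commute)

text \<open>
  The bound for \<open>adj A\<close> comes from
  \<open>\<parallel>adj A x\<parallel>\<^sup>2 = \<langle>x, A (adj A x)\<rangle> \<le> \<parallel>x\<parallel> K \<parallel>adj A x\<parallel>\<close>, where \<open>K\<close> is a bound for \<open>A\<close>.
\<close>

lemma bounded_clinear_adj:
  assumes "bounded_clinear A"
  shows "bounded_clinear (adj A)"
proof (rule bounded_clinearI)
  interpret bounded_linear A using assms by (rule bounded_clinearD)
  obtain K where K: "\<And>x. norm (A x) \<le> norm x * K" using bounded by blast
  show "bounded_linear (adj A)"
  proof (rule bounded_linear_intro[where K = K])
    fix x y show "adj A (x + y) = adj A x + adj A y"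
      by (intro iffD1[OF vector_eq_rdot])
        (simp add: inner_adj_left[OF assms] inner_add_left)
  next
    fix r x show "adj A (r *\<^sub>R x) = r *\<^sub>R adj A x"
      by (intro iffD1[OF vector_eq_rdot])
        (simp add: inner_adj_left[OF assms])
  next
    fix x
    have "norm (adj A x) * norm (adj A x) = inner x (A (adj A x))"
      using inner_adj_left[OF assms, of x "adj A x"]
      by (simp add: power2_norm_eq_inner flip: power2_eq_square)
    also have "\<dots> \<le> norm x * norm (A (adj A x))" by (rule norm_cauchy_schwarz)
    also have "\<dots> \<le> norm x * (norm (adj A x) * K)" by (intro mult_left_mono K) auto
    finally have "norm (adj A x) * norm (adj A x) \<le> (norm x * K) * norm (adj A x)"
      by (simp add: mult_ac)
    moreover have "0 \<le> norm x * K"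
      using K[of x] norm_ge_zero order_trans by blast
    ultimately show "norm (adj A x) \<le> norm x * K"
      by (cases "norm (adj A x) = 0") (auto dest: mult_right_le_imp_le)
  qed
next
  fix x show "adj A (\<i> *\<^sub>C x) = \<i> *\<^sub>C adj A x"
    by (intro iffD1[OF vector_eq_rdot])
      (simp add: inner_adj_left[OF assms] inner_scaleC_i bounded_clinearD[OF assms])
qed

lemma adj_adj: "bounded_clinear A \<Longrightarrow> adj (adj A) = A"
  by (intro adj_eqI bounded_clinear_adj inner_adj_left)

lemma adj_compose:
  "bounded_clinear A \<Longrightarrow> bounded_clinear B \<Longrightarrow> adj (A \<circ> B) = adj B \<circ> adj A"
  by (intro adj_eqI bounded_clinear_compose) (simp_all add: inner_adj_right)

section \<open>Positive operators and their square roots\<close>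

text \<open>
  A solution \<open>Y\<close> of \<open>Y = (B + Y\<^sup>2) / 2\<close> gives a square root \<open>1 - Y\<close> of \<open>1 - B\<close>. For \<open>\<parallel>B\<parallel> \<le> 1\<close> the
  iteration from \<open>0\<close> need not be a contraction, but it is dominated, term by term and increment by
  increment, by the same iteration for the real number \<open>1\<close> in place of \<open>B\<close>. That scalar sequence is
  increasing and bounded by \<open>1\<close>, so the increments of the operator sequence are summable in norm.
\<close>

primrec sqrt_iter :: "('a::real_normed_vector \<Rightarrow>\<^sub>L 'a) \<Rightarrow> nat \<Rightarrow> 'a \<Rightarrow>\<^sub>L 'a" where
  "sqrt_iter B 0 = 0"
| "sqrt_iter B (Suc n) = (1/2) *\<^sub>R (B + (sqrt_iter B n o\<^sub>L sqrt_iter B n))"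

primrec sqrt_majorant :: "nat \<Rightarrow> real" where
  "sqrt_majorant 0 = 0"
| "sqrt_majorant (Suc n) = (1 + (sqrt_majorant n)\<^sup>2) / 2"

lemma sqrt_majorant_bounds: "0 \<le> sqrt_majorant n \<and> sqrt_majorant n \<le> 1"
  by (induction n) (auto simp: power_le_one)

lemma sqrt_majorant_Suc_ge: "sqrt_majorant n \<le> sqrt_majorant (Suc n)"
  using zero_le_power2[of "1 - sqrt_majorant n"] by (simp add: power2_diff)

lemma norm_sqrt_iter_le:
  assumes "norm B \<le> 1"
  shows "norm (sqrt_iter B n) \<le> sqrt_majorant n"
proof (induction n)
  case (Suc n)
  have "norm (B + (sqrt_iter B n o\<^sub>L sqrt_iter B n)) \<le>
      norm B + norm (sqrt_iter B n) * norm (sqrt_iter B n)"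
    by (intro norm_triangle_le add_left_mono norm_blinfun_compose)
  also have "\<dots> \<le> 1 + sqrt_majorant n * sqrt_majorant n"
    by (intro add_mono mult_mono assms Suc) (auto simp: sqrt_majorant_bounds)
  finally show ?case by (simp add: power2_eq_square)
qed simp

text \<open>
  The step from \<open>Y\<close>, \<open>Z\<close> to the next increment uses \<open>Z\<^sup>2 - Y\<^sup>2 = Z (Z - Y) + (Z - Y) Y\<close>, which holds
  without commutativity and becomes an equality of the majorants.
\<close>

lemma norm_sqrt_iter_diff_le:
  assumes "norm B \<le> 1"
  shows "norm (sqrt_iter B (Suc n) - sqrt_iter B n) \<le> sqrt_majorant (Suc n) - sqrt_majorant n"
proof (induction n)
  case 0
  then show ?case using assms by simp
next
  case (Suc n)
  define Y Z y z where "Y = sqrt_iter B n" and "Z = sqrt_iter B (Suc n)"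
    and "y = sqrt_majorant n" and "z = sqrt_majorant (Suc n)"
  note defs = Y_def Z_def y_def z_def
  have "sqrt_iter B (Suc (Suc n)) - sqrt_iter B (Suc n) = (1/2) *\<^sub>R ((Z o\<^sub>L Z) - (Y o\<^sub>L Y))"
    unfolding sqrt_iter.simps(2)[of B "Suc n"] unfolding defs sqrt_iter.simps(2)[of B n]
    by (simp only: scaleR_diff_right[symmetric] add_diff_cancel_left)
  also have "(Z o\<^sub>L Z) - (Y o\<^sub>L Y) = (Z o\<^sub>L (Z - Y)) + ((Z - Y) o\<^sub>L Y)"
    by (simp add: bounded_bilinear.diff_left[OF bounded_bilinear_blinfun_compose]
        bounded_bilinear.diff_right[OF bounded_bilinear_blinfun_compose])
  finally have "norm (sqrt_iter B (Suc (Suc n)) - sqrt_iter B (Suc n)) =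
      (1/2) * norm ((Z o\<^sub>L (Z - Y)) + ((Z - Y) o\<^sub>L Y))"
    by (simp only: norm_scaleR)
  also have "\<dots> \<le> (1/2) * (norm Z * norm (Z - Y) + norm (Z - Y) * norm Y)"
    by (intro mult_left_mono norm_triangle_le add_mono norm_blinfun_compose) simp
  also have "\<dots> \<le> (1/2) * (z * (z - y) + (z - y) * y)"
    unfolding defs
    by (intro mult_left_mono add_mono mult_mono Suc norm_sqrt_iter_le[OF assms])
      (use sqrt_majorant_bounds sqrt_majorant_Suc_ge in \<open>auto simp del: sqrt_majorant.simps\<close>)
  also have "\<dots> = (z\<^sup>2 - y\<^sup>2) / 2"
    by (simp add: power2_eq_square algebra_simps)
  also have "\<dots> = sqrt_majorant (Suc (Suc n)) - sqrt_majorant (Suc n)"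
    by (simp add: defs diff_divide_distrib add_divide_distrib)
  finally show ?case .
qed

lemma sqrt_iter_convergent:
  fixes B :: "'a::banach \<Rightarrow>\<^sub>L 'a"
  assumes "norm B \<le> 1"
  shows "convergent (sqrt_iter B)"
proof -
  have "incseq sqrt_majorant" by (intro incseq_SucI sqrt_majorant_Suc_ge)
  then obtain l where "sqrt_majorant \<longlonglongrightarrow> l"
    using sqrt_majorant_bounds incseq_convergent by metis
  then have "summable (\<lambda>n. sqrt_majorant (Suc n) - sqrt_majorant n)"
    by (rule telescope_summable)
  then have "summable (\<lambda>n. sqrt_iter B (Suc n) - sqrt_iter B n)"
    by (rule summable_comparison_test') (rule norm_sqrt_iter_diff_le[OF assms])
  then have "convergent (\<lambda>n. \<Sum>k<n. sqrt_iter B (Suc k) - sqrt_iter B k)"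
    by (simp only: summable_iff_convergent)
  then show ?thesis by (simp only: sum_lessThan_telescope sqrt_iter.simps(1) diff_zero)
qed

lemma sqrt_iter_commute:
  assumes "C o\<^sub>L B = B o\<^sub>L C"
  shows "C o\<^sub>L sqrt_iter B n = sqrt_iter B n o\<^sub>L C"
proof (induction n)
  case (Suc n)
  have "blinfun_apply C (B x) = B (C x)"
    "blinfun_apply C (sqrt_iter B n x) = sqrt_iter B n (C x)" for x
    using assms Suc by (metis blinfun_apply_blinfun_compose)+
  then show ?case
    by (intro blinfun_eqI) (simp add: blinfun.bilinear_simps)
qed simp

lemma sqrt_iter_symmetric:
  fixes B :: "'a::real_inner \<Rightarrow>\<^sub>L 'a"
  assumes "\<And>x y. inner (B x) y = inner x (B y)"
  shows "inner (sqrt_iter B n x) y = inner x (sqrt_iter B n y)"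
  using assms by (induction n arbitrary: x y) (simp_all add: blinfun.bilinear_simps inner_simps)

text \<open>
  The square root is \<open>1 - Y\<close> with \<open>Y\<close> the limit of the iteration for \<open>B = 1 - A\<close>. It is symmetric,
  and it commutes with whatever commutes with \<open>A\<close>, because every iterate has these properties with
  respect to \<open>B\<close>; it is positive because \<open>\<parallel>Y\<parallel> \<le> 1\<close>.
\<close>

lemma positive_contraction_sqrt:
  fixes A :: "'a::{real_inner, banach} \<Rightarrow>\<^sub>L 'a"
  assumes sym: "\<And>x y. inner (A x) y = inner x (A y)"
    and pos: "\<And>x. 0 \<le> inner (A x) x"
    and norm: "norm A \<le> 1"
  obtains S :: "'a \<Rightarrow>\<^sub>L 'a" where "\<And>x y. inner (S x) y = inner x (S y)"
    "\<And>x. 0 \<le> inner (S x) x" "S o\<^sub>L S = A" "\<And>C. C o\<^sub>L A = A o\<^sub>L C \<Longrightarrow> C o\<^sub>L S = S o\<^sub>L C"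
proof -
  define B where "B = id_blinfun - A"
  have A_le: "norm (A x) \<le> norm x" for x
    using norm_blinfun[of A x] norm mult_right_mono[of "norm A" 1 "norm x"] by simp
  have "norm B \<le> 1"
  proof (rule norm_blinfun_bound)
    fix x
    \<comment> \<open>Positivity at \<open>x - A x\<close> gives \<open>\<parallel>A x\<parallel>\<^sup>2 \<le> \<langle>A x, x\<rangle>\<close>.\<close>
    have "0 \<le> inner (A (x - A x)) (x - A x)" by (rule pos)
    also have "\<dots> = inner (A x) x - 2 * (norm (A x))\<^sup>2 + inner (A (A x)) (A x)"
      using sym[of "A x" x]
      by (simp add: blinfun.diff_right inner_simps power2_norm_eq_inner inner_commute)
    also have "inner (A (A x)) (A x) \<le> (norm (A x))\<^sup>2"
      using norm_cauchy_schwarz[of "A (A x)" "A x"]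
        mult_right_mono[OF A_le[of "A x"] norm_ge_zero[of "A x"]]
      by (simp add: power2_eq_square)
    finally have "(norm (A x))\<^sup>2 \<le> inner (A x) x" by simp
    then have "(norm (B x))\<^sup>2 \<le> (norm x)\<^sup>2"
      using pos[of x]
      by (simp add: B_def blinfun.diff_left inner_simps power2_norm_eq_inner inner_commute)
    then have "norm (B x) \<le> norm x" by (rule power2_le_imp_le) simp
    then show "norm (B x) \<le> 1 * norm x" by simp
  qed simp
  then obtain Y where Y: "sqrt_iter B \<longlonglongrightarrow> Y"
    using sqrt_iter_convergent convergent_def by blast
  define S where "S = id_blinfun - Y"
  have Yx: "(\<lambda>n. sqrt_iter B n x) \<longlonglongrightarrow> Y x" for x
    by (intro tendsto_intros Y)
  have Ysym: "inner (Y x) y = inner x (Y y)" for x y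
  proof (rule LIMSEQ_unique)
    show "(\<lambda>n. inner (sqrt_iter B n x) y) \<longlonglongrightarrow> inner (Y x) y"
      by (intro tendsto_intros Yx)
    have "inner (B x) y = inner x (B y)" for x y
      by (simp add: B_def blinfun.diff_left inner_simps sym)
    then show "(\<lambda>n. inner (sqrt_iter B n x) y) \<longlonglongrightarrow> inner x (Y y)"
      by (subst sqrt_iter_symmetric) (auto intro!: tendsto_intros Yx)
  qed
  have "(\<lambda>n. sqrt_iter B (Suc n)) \<longlonglongrightarrow> (1/2) *\<^sub>R (B + (Y o\<^sub>L Y))"
    unfolding sqrt_iter.simps
    by (intro tendsto_intros Y bounded_bilinear.tendsto[OF bounded_bilinear_blinfun_compose])
  then have fixpoint: "Y = (1/2) *\<^sub>R (B + (Y o\<^sub>L Y))"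
    using LIMSEQ_Suc[OF Y] LIMSEQ_unique by blast
  have "S o\<^sub>L S = A"
  proof (rule blinfun_eqI)
    fix x
    have "Y x = (1/2) *\<^sub>R (B x + Y (Y x))"
      by (subst (1) fixpoint) (simp add: blinfun.bilinear_simps)
    then have "2 *\<^sub>R Y x = 2 *\<^sub>R ((1/2) *\<^sub>R (B x + Y (Y x)))" by (rule arg_cong)
    then have "Y (Y x) = 2 *\<^sub>R Y x - B x" by (simp only: scaleR_scaleR) simp
    then show "(S o\<^sub>L S) x = A x"
      by (simp add: S_def B_def blinfun.bilinear_simps scaleR_2 algebra_simps)
  qed
  moreover have "inner (S x) y = inner x (S y)" for x y
    by (simp add: S_def blinfun.bilinear_simps inner_simps Ysym)
  moreover have "0 \<le> inner (S x) x" for x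
  proof -
    have "norm (sqrt_iter B n) \<le> 1" for n
      using norm_sqrt_iter_le[OF \<open>norm B \<le> 1\<close>] sqrt_majorant_bounds order_trans by blast
    then have "norm Y \<le> 1"
      using LIMSEQ_le_const2[OF tendsto_norm[OF Y]] by blast
    then have "norm (Y x) \<le> norm x"
      using norm_blinfun[of Y x] mult_right_mono[of "norm Y" 1 "norm x"] by simp
    then have "inner (Y x) x \<le> inner x x"
      using norm_cauchy_schwarz[of "Y x" x] mult_right_mono[of "norm (Y x)" "norm x" "norm x"]
      by (simp add: power2_eq_square flip: power2_norm_eq_inner)
    then show ?thesis by (simp add: S_def blinfun.bilinear_simps inner_simps)
  qed
  moreover have "C o\<^sub>L S = S o\<^sub>L C" if "C o\<^sub>L A = A o\<^sub>L C" for C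
  proof -
    have comm: "blinfun_apply C (A x) = A (C x)" for x
      using that by (metis blinfun_apply_blinfun_compose)
    have "C o\<^sub>L B = B o\<^sub>L C"
      by (intro blinfun_eqI) (simp add: B_def blinfun.bilinear_simps comm)
    then have "(\<lambda>n. C o\<^sub>L sqrt_iter B n) = (\<lambda>n. sqrt_iter B n o\<^sub>L C)"
      using sqrt_iter_commute by blast
    moreover have "(\<lambda>n. C o\<^sub>L sqrt_iter B n) \<longlonglongrightarrow> (C o\<^sub>L Y)"
      "(\<lambda>n. sqrt_iter B n o\<^sub>L C) \<longlonglongrightarrow> (Y o\<^sub>L C)"
      by (intro tendsto_const Y bounded_bilinear.tendsto[OF bounded_bilinear_blinfun_compose])+
    ultimately have "C o\<^sub>L Y = Y o\<^sub>L C" using LIMSEQ_unique by metis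
    then have "blinfun_apply C (Y x) = Y (C x)" for x by (metis blinfun_apply_blinfun_compose)
    then show ?thesis
      by (intro blinfun_eqI) (simp add: S_def blinfun.bilinear_simps)
  qed
  ultimately show ?thesis using that by blast
qed

lemma positive_sqrt_real:
  fixes A :: "'a::{real_inner, banach} \<Rightarrow> 'a"
  assumes "bounded_linear A"
    and sym: "\<And>x y. inner (A x) y = inner x (A y)"
    and pos: "\<And>x. 0 \<le> inner (A x) x"
  obtains S where "bounded_linear S" "\<And>x y. inner (S x) y = inner x (S y)"
    "\<And>x. 0 \<le> inner (S x) x" "S \<circ> S = A"
    "\<And>C x. bounded_linear C \<Longrightarrow> (\<And>x. C (A x) = A (C x)) \<Longrightarrow> C (S x) = S (C x)"
proof -
  define K where "K = norm (Blinfun A) + 1"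
  define A' where "A' = (1/K) *\<^sub>R Blinfun A"
  have K: "K > 0" by (simp add: K_def add_nonneg_pos)
  have A'x: "A' x = (1/K) *\<^sub>R A x" for x
    by (simp add: A'_def blinfun.bilinear_simps bounded_linear_Blinfun_apply assms(1))
  have "norm A' \<le> 1"
    using K by (simp add: A'_def K_def divide_simps)
  moreover have "inner (A' x) y = inner x (A' y)" "0 \<le> inner (A' x) x" for x y
    using K sym pos by (simp_all add: A'x)
  ultimately obtain S' where S': "\<And>x y. inner (blinfun_apply S' x) y = inner x (S' y)"
    "\<And>x. 0 \<le> inner (S' x) x" "S' o\<^sub>L S' = A'" "\<And>C. C o\<^sub>L A' = A' o\<^sub>L C \<Longrightarrow> C o\<^sub>L S' = S' o\<^sub>L C"
    using positive_contraction_sqrt by metis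
  define S where "S = (\<lambda>x. sqrt K *\<^sub>R S' x)"
  have S'S': "S' (S' x) = (1/K) *\<^sub>R A x" for x
    using S'(3) A'x by (metis blinfun_apply_blinfun_compose)
  show ?thesis
  proof (rule that)
    show "bounded_linear S" unfolding S_def
      by (intro bounded_linear_compose[OF bounded_linear_scaleR_right] blinfun.bounded_linear_right)
    show "inner (S x) y = inner x (S y)" for x y by (simp add: S_def S')
    show "0 \<le> inner (S x) x" for x using K S'(2)[of x] by (simp add: S_def)
    show "S \<circ> S = A"
      using K by (auto simp: S_def fun_eq_iff blinfun.bilinear_simps S'S')
    fix C x assume C: "bounded_linear C" "\<And>x. C (A x) = A (C x)"
    interpret C: bounded_linear C by fact
    have "Blinfun C o\<^sub>L A' = A' o\<^sub>L Blinfun C"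
      by (intro blinfun_eqI) (simp add: A'x bounded_linear_Blinfun_apply C C.scaleR)
    then have "Blinfun C o\<^sub>L S' = S' o\<^sub>L Blinfun C" by (rule S'(4))
    then have "C (S' x) = S' (C x)" for x
      by (metis blinfun_apply_blinfun_compose bounded_linear_Blinfun_apply C(1))
    then show "C (S x) = S (C x)" by (simp add: S_def C.scaleR)
  qed
qed

text \<open>
  On a complex space a quadratic form with real values comes from a symmetric operator, by
  polarisation. Conversely, symmetry forces \<open>\<langle>A x, x\<rangle>\<close> to be real. This description is the one in
  which the square root over the reals applies.
\<close>

lemma positive_op_iff:
  "positive_op A \<longleftrightarrow> bounded_clinear A \<and> (\<forall>x y. inner (A x) y = inner x (A y)) \<and> (\<forall>x. 0 \<le> inner (A x) x)"
proof (intro iffI conjI allI)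
  assume "positive_op A"
  then have A: "bounded_clinear A" and real: "inner (A x) (\<i> *\<^sub>C x) = 0"
    and "0 \<le> inner (A x) x" for x
    by (auto simp: positive_op_def cinner_eq_inner complex_nonneg_Reals_iff)
  then show "bounded_clinear A" "0 \<le> inner (A x) x" for x by auto
  interpret bounded_linear A using A by (rule bounded_clinearD)
  interpret i: bounded_linear "\<lambda>x::'a. \<i> *\<^sub>C x" by (rule bounded_linear_scaleC)
  fix x y
  \<comment> \<open>Polarise the identity \<open>real\<close>.\<close>
  have "inner (A x) (\<i> *\<^sub>C \<i> *\<^sub>C y) + inner (A (\<i> *\<^sub>C y)) (\<i> *\<^sub>C x) = 0"
    using real[of "x + \<i> *\<^sub>C y"] real[of x] real[of "\<i> *\<^sub>C y"]
    by (simp add: add i.add inner_simps)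
  then show "inner (A x) y = inner x (A y)"
    using inner_scaleC_i[of "A y" "\<i> *\<^sub>C x"]
    by (simp add: bounded_clinearD[OF A] inner_commute)
next
  assume R: "bounded_clinear A \<and> (\<forall>x y. inner (A x) y = inner x (A y)) \<and> (\<forall>x. 0 \<le> inner (A x) x)"
  have "inner (A x) (\<i> *\<^sub>C x) = 0" for x
  proof -
    have "inner (A x) (\<i> *\<^sub>C x) = inner x (\<i> *\<^sub>C A x)"
      using R by (simp add: bounded_clinearD)
    also have "\<dots> = - inner (A x) (\<i> *\<^sub>C x)"
      using inner_scaleC_i[of x "A x"] by (simp add: inner_commute)
    finally show ?thesis by simp
  qed
  with R show "positive_op A"
    by (auto simp: positive_op_def cinner_eq_inner complex_nonneg_Reals_iff)
qed

lemma positive_opD: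
  assumes "positive_op A"
  shows "bounded_clinear A" "inner (A x) y = inner x (A y)" "0 \<le> inner (A x) x"
  using assms by (auto simp: positive_op_iff)

lemma adj_positive: "positive_op A \<Longrightarrow> adj A = A"
  by (intro adj_eqI positive_opD)

text \<open>
  The square root found over the reals commutes with every operator that commutes with \<open>A\<close>; taking
  multiplication by \<open>\<i>\<close> for that operator shows that the root is complex linear.
\<close>

lemma positive_sqrt_exists:
  fixes A :: "'a::chilbert_space \<Rightarrow> 'a"
  assumes "positive_op A"
  shows "\<exists>S. positive_op S \<and> S \<circ> S = A \<and>
    (\<forall>C. bounded_linear C \<longrightarrow> C \<circ> A = A \<circ> C \<longrightarrow> C \<circ> S = S \<circ> C)"
proof -
  note A = positive_opD[OF assms]
  show ?thesis
  proof (rule positive_sqrt_real[OF bounded_clinearD(1)[OF A(1)] A(2,3)])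
    fix S assume S: "bounded_linear S" "\<And>x y. inner (S x) y = inner x (S y)"
      "\<And>x. 0 \<le> inner (S x) x" "S \<circ> S = A"
      "\<And>C x. bounded_linear C \<Longrightarrow> (\<And>x. C (A x) = A (C x)) \<Longrightarrow> C (S x) = S (C x)"
    have "S (\<i> *\<^sub>C x) = \<i> *\<^sub>C S x" for x
      using S(5)[OF bounded_linear_scaleC, of \<i> x] by (simp add: bounded_clinearD(2)[OF A(1)])
    then have "positive_op S"
      using S(1-3) by (simp add: positive_op_iff bounded_clinearI)
    moreover have "C \<circ> S = S \<circ> C" if "bounded_linear C" "C \<circ> A = A \<circ> C" for C
      using S(5)[OF that(1)] that(2) by (simp add: fun_eq_iff)
    ultimately show ?thesis using S(4) by blast
  qed
qed

text \<open>
  With \<open>A = S\<^sup>2\<close> the hypothesis reads \<open>\<parallel>S x\<parallel>\<^sup>2 = 0\<close>.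
\<close>

lemma positive_op_eq_0:
  fixes A :: "'a::chilbert_space \<Rightarrow> 'a"
  assumes "positive_op A" "inner (A x) x = 0"
  shows "A x = 0"
proof -
  obtain S where S: "positive_op S" "S \<circ> S = A"
    using positive_sqrt_exists[OF assms(1)] by blast
  then have "inner (S x) (S x) = 0"
    using assms(2) positive_opD(2)[OF S(1), of "S x" x] by auto
  moreover have "S 0 = 0"
    by (rule linear_simps(3)[OF bounded_clinearD(1)[OF positive_opD(1)[OF S(1)]]])
  ultimately show ?thesis using S(2) by auto
qed

lemma positive_sqrt_unique_commuting:
  fixes S R :: "'a::chilbert_space \<Rightarrow> 'a"
  assumes "positive_op S" "positive_op R" "S \<circ> S = R \<circ> R" "R \<circ> S = S \<circ> R"
  shows "S = R"
proof
  fix x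
  interpret S: bounded_linear S by (rule bounded_clinearD(1)[OF positive_opD(1)[OF assms(1)]])
  interpret R: bounded_linear R by (rule bounded_clinearD(1)[OF positive_opD(1)[OF assms(2)]])
  define y where "y = S x - R x"
  have SR: "S (S x) = R (R x)" "R (S x) = S (R x)"
    using assms(3,4) by (simp_all add: fun_eq_iff)
  \<comment> \<open>\<open>(S + R) (S - R) = 0\<close>, so both quadratic forms vanish at \<open>y\<close>.\<close>
  have sum: "S y + R y = 0"
    by (simp add: y_def S.diff R.diff SR)
  then have "inner (S y) y + inner (R y) y = 0"
    by (metis inner_add_left inner_zero_left)
  then have "inner (S y) y = 0" "inner (R y) y = 0"
    using positive_opD(3)[OF assms(1), of y] positive_opD(3)[OF assms(2), of y] by linarith+
  then have "S y = 0" "R y = 0"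
    using positive_op_eq_0 assms by blast+
  have "inner y y = inner x (S y - R y)"
    using positive_opD(2)[OF assms(1), of x y] positive_opD(2)[OF assms(2), of x y]
    by (subst (1) y_def) (simp add: inner_simps)
  then show "S x = R x"
    using \<open>S y = 0\<close> \<open>R y = 0\<close> by (simp add: y_def)
qed

text \<open>
  That \<open>S\<close> and \<open>R\<close> commute is not clear in advance. Each of them commutes with the common square,
  hence with the particular root \<open>Q\<close> that commutes with everything commuting with that square; so
  each of them equals \<open>Q\<close>.
\<close>

lemma positive_sqrt_unique:
  fixes S R :: "'a::chilbert_space \<Rightarrow> 'a"
  assumes "positive_op S" "positive_op R" "S \<circ> S = R \<circ> R"
  shows "S = R"
proof -
  have sq: "bounded_clinear (S \<circ> S)"
    using assms positive_opD bounded_clinear_compose by blast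
  interpret S: bounded_linear S by (rule bounded_clinearD(1)[OF positive_opD(1)[OF assms(1)]])
  interpret R: bounded_linear R by (rule bounded_clinearD(1)[OF positive_opD(1)[OF assms(2)]])
  have "positive_op (S \<circ> S)"
    using sq positive_opD(2)[OF assms(1)] by (auto simp: positive_op_iff) (metis inner_ge_zero)
  then obtain Q where Q: "positive_op Q" "Q \<circ> Q = S \<circ> S"
    and comm: "\<And>C. bounded_linear C \<Longrightarrow> C \<circ> (S \<circ> S) = (S \<circ> S) \<circ> C \<Longrightarrow> C \<circ> Q = Q \<circ> C"
    using positive_sqrt_exists by blast
  have "S \<circ> Q = Q \<circ> S"
    by (rule comm[OF S.bounded_linear_axioms]) (simp add: comp_assoc)
  then have "Q = S"
    by (rule positive_sqrt_unique_commuting[OF Q(1) assms(1) Q(2)])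
  have "R \<circ> Q = Q \<circ> R"
    by (rule comm[OF R.bounded_linear_axioms]) (simp add: assms(3) comp_assoc)
  then have "Q = R"
    by (rule positive_sqrt_unique_commuting[OF Q(1) assms(2) Q(2)[unfolded assms(3)]])
  with \<open>Q = S\<close> show ?thesis by simp
qed

lemma sqrt_op_eqI:
  assumes "positive_op S" "S \<circ> S = A"
  shows "sqrt_op A = S"
  unfolding sqrt_op_def using assms by (auto intro!: the_equality positive_sqrt_unique)

lemma sqrt_op_positive:
  assumes "positive_op A"
  shows "positive_op (sqrt_op A)" "sqrt_op A \<circ> sqrt_op A = A"
proof -
  obtain S where "positive_op S" "S \<circ> S = A"
    using positive_sqrt_exists[OF assms] by blast
  then show "positive_op (sqrt_op A)" "sqrt_op A \<circ> sqrt_op A = A"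
    using sqrt_op_eqI[of S A] by auto
qed

lemma positive_opI:
  assumes "bounded_clinear A" "\<And>x y. inner (A x) y = inner x (A y)" "\<And>x. 0 \<le> inner (A x) x"
  shows "positive_op A"
  using assms by (simp add: positive_op_iff)

lemma positive_op_conj:
  assumes C: "bounded_clinear C" and A: "positive_op A"
  shows "positive_op (adj C \<circ> A \<circ> C)"
proof (rule positive_opI)
  show "bounded_clinear (adj C \<circ> A \<circ> C)"
    using C positive_opD(1)[OF A] by (intro bounded_clinear_compose bounded_clinear_adj)
  show "inner ((adj C \<circ> A \<circ> C) x) y = inner x ((adj C \<circ> A \<circ> C) y)" for x y
    using positive_opD(2)[OF A]
    by (simp add: inner_adj_left[OF C] flip: inner_adj_right[OF C])
  show "0 \<le> inner ((adj C \<circ> A \<circ> C) x) x" for x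
    using positive_opD(3)[OF A, of "C x"] by (simp add: inner_adj_left[OF C])
qed

lemma op_le_conj:
  assumes "bounded_clinear C" "A \<preceq> B"
  shows "adj C \<circ> A \<circ> C \<preceq> adj C \<circ> B \<circ> C"
proof -
  interpret bounded_linear "adj C" by (rule bounded_clinearD(1)[OF bounded_clinear_adj[OF assms(1)]])
  have "adj C \<circ> (\<lambda>x. B x - A x) \<circ> C = (\<lambda>x. (adj C \<circ> B \<circ> C) x - (adj C \<circ> A \<circ> C) x)"
    by (simp add: fun_eq_iff diff)
  then show ?thesis
    using positive_op_conj[OF assms(1) assms(2)[unfolded op_le_def]] unfolding op_le_def by metis
qed

lemma positive_op_scaleR_iff:
  fixes A :: "'a::complex_inner \<Rightarrow> 'a"
  assumes "r > 0"
  shows "positive_op (\<lambda>x. r *\<^sub>R A x) \<longleftrightarrow> positive_op A"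
proof -
  have "positive_op (\<lambda>x. r *\<^sub>R A x)" if "r > 0" "positive_op A" for r and A :: "'a \<Rightarrow> 'a"
    using that bounded_clinear_scaleC[of A "complex_of_real r"] positive_opD[OF that(2)]
    by (intro positive_opI) (simp_all flip: scaleR_scaleC)
  from this[of r A] this[of "1/r" "\<lambda>x. r *\<^sub>R A x"] assms show ?thesis by auto
qed

lemma positive_op_add:
  assumes A: "positive_op A" and B: "positive_op B"
  shows "positive_op (\<lambda>x. A x + B x)"
proof (rule positive_opI)
  show "bounded_clinear (\<lambda>x. A x + B x)"
    using A B by (intro bounded_clinear_add positive_opD)
  show "inner (A x + B x) y = inner x (A y + B y)" for x y
    by (simp add: inner_simps positive_opD(2)[OF A] positive_opD(2)[OF B])
  show "0 \<le> inner (A x + B x) x" for x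
    using positive_opD(3)[OF A] positive_opD(3)[OF B] by (simp add: inner_add_left)
qed

lemma closed_subspace_ker:
  assumes "bounded_clinear A"
  shows "closed (ker A)" "subspace (ker A)"
proof -
  interpret bounded_linear A using assms by (rule bounded_clinearD)
  show "closed (ker A)"
    by (intro closed_Collect_eq continuous_intros continuous_on)
  show "subspace (ker A)"
    by (auto intro!: subspaceI simp: add scaleR)
qed

section \<open>The polar decomposition\<close>

text \<open>
  \<open>V\<close> preserves inner products on the orthogonal complement of its kernel, hence \<open>adj V \<circ> V\<close> is the
  orthogonal projection onto that complement, and \<open>V\<close> does not see the difference between a vector
  and its projection.
\<close>

lemma partial_isometry_compose_adj:
  assumes "partial_isometry V"
  shows "V (adj V (V x)) = V x"
proof -
  have V: "bounded_clinear V" using assms by (simp add: partial_isometry_def)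
  interpret bounded_linear V using V by (rule bounded_clinearD)
  have iso: "norm (V k) = norm k" if "\<And>n. V n = 0 \<Longrightarrow> inner k n = 0" for k
  proof -
    have "V (\<i> *\<^sub>C n) = 0" if "V n = 0" for n
      using that linear_simps(3)[OF bounded_linear_scaleC] by (simp add: bounded_clinearD(2)[OF V])
    then have "\<forall>n\<in>ker V. cinner k n = 0"
      using that by (simp add: cinner_eq_inner complex_eq_iff)
    then show ?thesis using assms by (simp add: partial_isometry_def)
  qed
  have iso_inner: "inner (V k) (V l) = inner k l"
    if "\<And>n. V n = 0 \<Longrightarrow> inner k n = 0" "\<And>n. V n = 0 \<Longrightarrow> inner l n = 0" for k l
  proof -
    have "norm (V k + V l) = norm (k + l)"
      using iso[of "k + l"] that by (simp add: add inner_add_left)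
    then show ?thesis using iso[of k] iso[of l] that by (simp only: dot_norm)
  qed
  obtain p where p: "V p = 0" "\<And>n. V n = 0 \<Longrightarrow> inner (x - p) n = 0"
    using orthogonal_projection[OF closed_subspace_ker[OF V], of x] by auto
  have "inner (adj V (V x)) y = inner (x - p) y" for y
  proof -
    obtain q where q: "V q = 0" "\<And>n. V n = 0 \<Longrightarrow> inner (y - q) n = 0"
      using orthogonal_projection[OF closed_subspace_ker[OF V], of y] by auto
    have "inner (adj V (V x)) y = inner (V (x - p)) (V (y - q))"
      using p(1) q(1) by (simp add: inner_adj_left[OF V] diff)
    also have "\<dots> = inner (x - p) (y - q)"
      using p(2) q(2) by (rule iso_inner)
    also have "\<dots> = inner (x - p) y"
      using p(2)[OF q(1)] by (simp add: inner_diff_right)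
    finally show ?thesis .
  qed
  then have "adj V (V x) = x - p" by (metis vector_eq_rdot)
  then show ?thesis using p(1) by (simp add: diff)
qed

text \<open>
  The kernel of a self-adjoint operator is the orthogonal complement of its range, so every vector is
  the sum of a vector in the closure of the range and one in the kernel. Statements about
  operators that vanish on \<open>ker P\<close> can therefore be checked on \<open>range P\<close>.
\<close>

lemma ker_closure_range_decomposition:
  fixes P :: "'a::chilbert_space \<Rightarrow> 'a"
  assumes "positive_op P"
  obtains k where "k \<in> closure (range P)" "P (x - k) = 0"
proof -
  interpret bounded_linear P by (rule bounded_clinearD(1)[OF positive_opD(1)[OF assms]])
  have "subspace (range P)"
    by (rule linear_subspace_image[OF linear_axioms subspace_UNIV])
  then obtain k where k: "k \<in> closure (range P)"
    "\<And>y. y \<in> closure (range P) \<Longrightarrow> inner (x - k) y = 0"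
    using orthogonal_projection[OF closed_closure subspace_closure] by metis
  have "inner (P (x - k)) (P (x - k)) = inner (x - k) (P (P (x - k)))"
    by (rule positive_opD(2)[OF assms])
  also have "\<dots> = 0" using k(2) closure_subset by blast
  finally show ?thesis using that k(1) by simp
qed

lemma abs_op_positive:
  assumes "bounded_clinear T"
  shows "positive_op (abs_op T)" "abs_op T \<circ> abs_op T = adj T \<circ> T"
proof -
  have "positive_op (adj T \<circ> T)"
    by (intro positive_opI bounded_clinear_compose bounded_clinear_adj)
      (use assms in \<open>simp_all add: inner_adj_left flip: inner_adj_right\<close>)
  then show "positive_op (abs_op T)" "abs_op T \<circ> abs_op T = adj T \<circ> T"
    unfolding abs_op_def by (rule sqrt_op_positive)+
qed

lemma ker_abs_op:
  assumes "bounded_clinear T"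
  shows "ker (abs_op T) = ker T"
proof -
  have "inner (abs_op T x) (abs_op T x) = inner (T x) (T x)" for x
    using positive_opD(2)[OF abs_op_positive(1)[OF assms], of x "abs_op T x"]
      abs_op_positive(2)[OF assms] inner_adj_right[OF assms, of x "T x"]
    by (simp add: fun_eq_iff)
  then show ?thesis by (metis inner_eq_zero_iff)
qed

text \<open>
  Two partial isometric factors agree on the range of \<open>abs_op T\<close> since both products are \<open>T\<close>, and on
  the kernel of \<open>abs_op T\<close> since both vanish there; together these span a dense subspace.
\<close>

lemma polar_part_eq:
  assumes "bounded_clinear T" "polar_decomposition T V"
  shows "polar_part T = V"
  unfolding polar_part_def
proof (rule the_equality)
  show "polar_decomposition T V" by (rule assms(2))
next
  fix W assume W: "polar_decomposition T W"
  define P where "P = abs_op T"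
  have bl: "bounded_linear V" "bounded_linear W"
    using assms(2) W by (auto simp: polar_decomposition_def partial_isometry_def bounded_clinear_def)
  interpret V: bounded_linear V by fact
  interpret W: bounded_linear W by fact
  show "W = V"
  proof
    fix x
    obtain k where k: "k \<in> closure (range P)" "P (x - k) = 0"
      using ker_closure_range_decomposition abs_op_positive(1)[OF assms(1)] P_def by metis
    have "closed {y. W y = V y}"
      by (intro closed_Collect_eq continuous_intros W.continuous_on V.continuous_on)
    moreover have "range P \<subseteq> {y. W y = V y}"
      using assms(2) W unfolding polar_decomposition_def P_def by (auto simp: fun_eq_iff)
    ultimately have "W k = V k" using k(1) closure_minimal by blast
    moreover have "W (x - k) = 0" "V (x - k) = 0"
      using k(2) ker_abs_op[OF assms(1)] assms(2) W by (auto simp: polar_decomposition_def P_def)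
    ultimately show "W x = V x" by (simp add: V.diff W.diff)
  qed
qed

text \<open>
  The difference \<open>x - adj V (V x)\<close> lies in \<open>ker V = ker (abs_op T)\<close>.
\<close>

lemma polar_decomposition_initial_projection:
  assumes "bounded_clinear T" "polar_decomposition T V"
  shows "abs_op T \<circ> adj V \<circ> V = abs_op T"
proof
  fix x
  interpret V: bounded_linear V
    using assms(2) by (simp add: polar_decomposition_def partial_isometry_def bounded_clinear_def)
  interpret P: bounded_linear "abs_op T"
    by (rule bounded_clinearD(1)[OF positive_opD(1)[OF abs_op_positive(1)[OF assms(1)]]])
  have "V (x - adj V (V x)) = 0"
    using assms(2) by (simp add: V.diff partial_isometry_compose_adj polar_decomposition_def)
  then have "abs_op T (x - adj V (V x)) = 0"
    using assms(2) ker_abs_op[OF assms(1)] by (auto simp: polar_decomposition_def)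
  then show "(abs_op T \<circ> adj V \<circ> V) x = abs_op T x" by (simp add: P.diff)
qed

text \<open>
  The difference \<open>x - V (adj V x)\<close> lies in \<open>ker (adj V) \<subseteq> ker (adj T)\<close>. The hypothesis on the kernels
  puts it into \<open>ker T = ker (abs_op T)\<close>; this is how \<open>V\<close> comes to act as a unitary on the
  closure of the range of \<open>abs_op T\<close>.
\<close>

lemma polar_decomposition_final_projection:
  assumes "bounded_clinear T" "polar_decomposition T V" "ker (adj T) \<subseteq> ker T"
  shows "abs_op T \<circ> V \<circ> adj V = abs_op T"
proof
  fix x
  have V: "bounded_clinear V" and T: "T = V \<circ> abs_op T" and pi: "partial_isometry V"
    using assms(2) unfolding polar_decomposition_def partial_isometry_def by blast+
  note P = abs_op_positive(1)[OF assms(1)]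
  interpret adjV: bounded_linear "adj V" by (rule bounded_clinearD(1)[OF bounded_clinear_adj[OF V]])
  interpret P: bounded_linear "abs_op T" by (rule bounded_clinearD(1)[OF positive_opD(1)[OF P]])
  define y where "y = x - V (adj V x)"
  have "adj V (V (adj V x)) = adj V x"
  proof -
    have "inner (adj V (V (adj V x))) z = inner (adj V x) z" for z
      using partial_isometry_compose_adj[OF pi, of z]
      by (simp add: inner_adj_left[OF V]) (metis V inner_adj_left inner_adj_right)
    then show ?thesis by (metis vector_eq_rdot)
  qed
  then have "adj V y = 0" by (simp add: y_def adjV.diff)
  moreover have "adj T = abs_op T \<circ> adj V"
    using adj_compose[OF V positive_opD(1)[OF P]] T adj_positive[OF P] by metis
  ultimately have "adj T y = 0" by (simp add: P.zero)
  then have "abs_op T y = 0" using assms(3) ker_abs_op[OF assms(1)] by blast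
  then show "(abs_op T \<circ> V \<circ> adj V) x = abs_op T x" by (simp add: y_def P.diff)
qed

section \<open>Semi-hyponormality and hyponormality of the transforms\<close>

text \<open>
  When \<open>adj V \<circ> V\<close> fixes the range of \<open>A\<close>, the modulus of \<open>V \<circ> A\<close> is \<open>A\<close> and that of its adjoint is
  \<open>V \<circ> A \<circ> adj V\<close>: both are positive and have the right squares. The operator \<open>T\<close>, its Duggal
  transform and its mean transform all have the form \<open>V \<circ> A\<close> for a suitable positive \<open>A\<close>.
\<close>

lemma semi_hyponormal_compose_positive:
  assumes "bounded_clinear V" "positive_op A" "adj V \<circ> V \<circ> A = A"
  shows "semi_hyponormal (V \<circ> A) \<longleftrightarrow> V \<circ> A \<circ> adj V \<preceq> A"
proof -
  have adj: "adj (V \<circ> A) = A \<circ> adj V"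
    using assms by (simp add: adj_compose positive_opD adj_positive)
  have VVA: "adj V (V (A x)) = A x" for x using assms(3) by (metis comp_apply)
  have "sqrt_op (adj (V \<circ> A) \<circ> (V \<circ> A)) = A"
    using assms(2) by (intro sqrt_op_eqI) (auto simp: adj VVA)
  moreover have "sqrt_op ((V \<circ> A) \<circ> adj (V \<circ> A)) = V \<circ> A \<circ> adj V"
    using positive_op_conj[OF bounded_clinear_adj[OF assms(1)] assms(2)]
    by (intro sqrt_op_eqI) (auto simp: adj VVA adj_adj[OF assms(1)])
  ultimately show ?thesis by (simp add: semi_hyponormal_def)
qed

text \<open>
  If \<open>R D R\<close> is positive, the quadratic form of \<open>D\<close> is nonnegative on the range of \<open>R\<close>, hence on its
  closure, and \<open>D\<close> vanishes on the remaining summand \<open>ker R\<close>.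
\<close>

lemma positive_op_compression_iff:
  fixes R D :: "'a::chilbert_space \<Rightarrow> 'a"
  assumes R: "positive_op R" and D: "bounded_clinear D" "\<And>x y. inner (D x) y = inner x (D y)"
    and ker: "\<And>x. R x = 0 \<Longrightarrow> D x = 0"
  shows "positive_op (R \<circ> D \<circ> R) \<longleftrightarrow> positive_op D"
proof
  assume "positive_op D"
  then show "positive_op (R \<circ> D \<circ> R)"
    using positive_op_conj[OF positive_opD(1)[OF R]] adj_positive[OF R] by simp
next
  assume RDR: "positive_op (R \<circ> D \<circ> R)"
  interpret D: bounded_linear D using D(1) by (rule bounded_clinearD)
  have "0 \<le> inner (D x) x" for x
  proof -
    obtain k where k: "k \<in> closure (range R)" "R (x - k) = 0"
      using ker_closure_range_decomposition[OF R] by metis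
    have "closed {y. 0 \<le> inner (D y) y}"
      by (intro closed_Collect_le continuous_intros D.continuous_on)
    moreover have "range R \<subseteq> {y. 0 \<le> inner (D y) y}"
      using positive_opD(3)[OF RDR] by (auto simp: positive_opD(2)[OF R])
    ultimately have "0 \<le> inner (D k) k" using k(1) closure_minimal by blast
    also have "D k = D x" using ker[OF k(2)] by (simp add: D.diff)
    also have "inner (D x) k = inner (D x) x"
      using ker[OF k(2)] D(2)[of x "x - k"] by (simp add: inner_diff_right)
    finally show ?thesis .
  qed
  with D show "positive_op D" by (simp add: positive_op_iff)
qed

theorem theorem2p4:
  fixes T V :: "'a::chilbert_space \<Rightarrow> 'a"
  assumes "bounded_clinear T"
    and "polar_decomposition T V"
    and "ker T = ker (adj T)"
  shows
    "(semi_hyponormal T \<longleftrightarrow>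
        V \<circ> abs_op T \<circ> adj V \<preceq> abs_op T \<and> abs_op T \<preceq> adj V \<circ> abs_op T \<circ> V) \<and>
     (V \<circ> abs_op T \<circ> adj V \<preceq> abs_op T \<and> abs_op T \<preceq> adj V \<circ> abs_op T \<circ> V \<longleftrightarrow>
        semi_hyponormal (duggal_transform T)) \<and>
     (semi_hyponormal (duggal_transform T) \<longrightarrow> semi_hyponormal (mean_transform T)) \<and>
     (semi_hyponormal (mean_transform T) \<longleftrightarrow> hyponormal (aluthge_transform T)) \<and>
     (hyponormal (aluthge_transform T) \<longleftrightarrow>
        V \<circ> abs_op T \<circ> adj V \<preceq> adj V \<circ> abs_op T \<circ> V)"
proof -
  define P R W where "P = abs_op T" and "R = sqrt_op P" and "W = adj V"
  define L U where "L = V \<circ> P \<circ> W" and "U = W \<circ> P \<circ> V"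
  have V: "bounded_clinear V" and T: "T = V \<circ> P"
    using assms(2) unfolding polar_decomposition_def partial_isometry_def P_def by blast+
  have Tx: "T x = V (P x)" for x using T by (metis comp_apply)
  have W: "bounded_clinear W" and adjW: "adj W = V"
    using V by (simp_all add: W_def bounded_clinear_adj adj_adj)
  interpret V: bounded_linear V using V by (rule bounded_clinearD)
  interpret W: bounded_linear W using W by (rule bounded_clinearD)
  have P: "positive_op P" unfolding P_def using assms(1) by (rule abs_op_positive)
  have L: "positive_op L" and U: "positive_op U"
    using positive_op_conj[OF W P] positive_op_conj[OF V P] by (simp_all add: L_def U_def adjW flip: W_def)
  have PWV: "P \<circ> W \<circ> V = P" and PVW: "P \<circ> V \<circ> W = P"
    using polar_decomposition_initial_projection[OF assms(1,2)]
      polar_decomposition_final_projection[OF assms(1,2)] assms(3) by (simp_all add: P_def W_def)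
  have WVP: "W \<circ> V \<circ> P = P" and VWP: "V \<circ> W \<circ> P = P"
    using arg_cong[OF PWV, of adj] arg_cong[OF PVW, of adj]
    by (simp_all add: adj_compose bounded_clinear_compose V W positive_opD[OF P] adj_positive[OF P]
        adjW comp_assoc flip: W_def)
  have pw: "P (W (V x)) = P x" "P (V (W x)) = P x" "W (V (P x)) = P x" "V (W (P x)) = P x" for x
    using PWV PVW WVP VWP by (metis comp_apply)+
  have polar: "polar_part T = V" using assms(1,2) by (rule polar_part_eq)

  \<comment> \<open>The map \<open>X \<mapsto> W X V\<close> carries \<open>L\<close> to \<open>P\<close> and \<open>P\<close> to \<open>U\<close>; the map
    \<open>X \<mapsto> V X W\<close> reverses this.\<close>
  have LP_iff_PU: "L \<preceq> P \<longleftrightarrow> P \<preceq> U"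
  proof
    assume "L \<preceq> P"
    moreover have "W \<circ> L \<circ> V = P" by (simp add: fun_eq_iff L_def pw)
    ultimately show "P \<preceq> U" using op_le_conj[OF V] by (metis U_def W_def)
  next
    assume "P \<preceq> U"
    moreover have "V \<circ> U \<circ> W = P" by (simp add: fun_eq_iff U_def pw)
    ultimately show "L \<preceq> P" using op_le_conj[OF W] by (metis L_def adjW)
  qed
  have 1: "semi_hyponormal T \<longleftrightarrow> L \<preceq> P"
    using semi_hyponormal_compose_positive[OF V P] WVP by (simp add: L_def W_def flip: T)
  have 3: "semi_hyponormal (duggal_transform T) \<longleftrightarrow> P \<preceq> U"
  proof -
    \<comment> \<open>\<open>P V = (V W) P V = V U\<close>\<close>
    have "duggal_transform T = V \<circ> U"
      by (simp add: fun_eq_iff duggal_transform_def polar U_def pw flip: P_def)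
    moreover have "V \<circ> U \<circ> W = P" "W \<circ> V \<circ> U = U"
      by (simp_all add: fun_eq_iff U_def pw)
    ultimately show ?thesis
      using semi_hyponormal_compose_positive[OF V U] by (simp add: W_def)
  qed
  have 4: "semi_hyponormal (mean_transform T) \<longleftrightarrow> L \<preceq> U"
  proof -
    \<comment> \<open>\<open>V P + P V = V P + V U\<close>, and the summand \<open>P\<close> cancels in the comparison of the two moduli,
      which are \<open>(P + U) / 2\<close> and \<open>(L + P) / 2\<close>.\<close>
    define A where "A = (\<lambda>x. (1/2) *\<^sub>R (P x + U x))"
    have A: "positive_op A"
      unfolding A_def using positive_op_add[OF P U] by (simp add: positive_op_scaleR_iff)
    have "mean_transform T = V \<circ> A"
    proof -
      have "(1/2) *\<^sub>C x = (1/2) *\<^sub>R x" for x :: 'a by (simp add: scaleR_scaleC)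
      then show ?thesis
        by (simp add: fun_eq_iff mean_transform_def polar A_def U_def pw V.scaleR V.add Tx flip: P_def)
    qed
    moreover have "W \<circ> V \<circ> A = A"
      by (simp add: fun_eq_iff A_def U_def pw V.scaleR V.add W.scaleR W.add)
    ultimately have "semi_hyponormal (mean_transform T) \<longleftrightarrow> V \<circ> A \<circ> W \<preceq> A"
      using semi_hyponormal_compose_positive[OF V A] by (simp add: W_def)
    moreover have "A x - (V \<circ> A \<circ> W) x = (1/2) *\<^sub>R (U x - L x)" for x
      by (simp add: A_def L_def U_def pw V.scaleR V.add algebra_simps)
    ultimately show ?thesis by (simp add: op_le_def positive_op_scaleR_iff)
  qed
  have 5: "hyponormal (aluthge_transform T) \<longleftrightarrow> L \<preceq> U"
  proof -
    have R: "positive_op R" "R \<circ> R = P" using sqrt_op_positive[OF P] by (simp_all add: R_def)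
    have RR: "R (R x) = P x" for x using R(2) by (metis comp_apply)
    interpret R: bounded_linear R by (rule bounded_clinearD(1)[OF positive_opD(1)[OF R(1)]])
    interpret P: bounded_linear P by (rule bounded_clinearD(1)[OF positive_opD(1)[OF P]])
    have D: "aluthge_transform T = R \<circ> V \<circ> R"
      by (simp add: aluthge_transform_def polar R_def P_def)
    have adjD: "adj (R \<circ> V \<circ> R) = R \<circ> W \<circ> R"
      using V positive_opD(1)[OF R(1)]
      by (simp add: adj_compose bounded_clinear_compose adj_positive[OF R(1)] comp_assoc flip: W_def)
    \<comment> \<open>The inner factor \<open>R \<circ> R = P\<close> turns the self-commutator into a compression of \<open>U - L\<close>.\<close>
    have "(adj (aluthge_transform T) \<circ> aluthge_transform T) x
        - (aluthge_transform T \<circ> adj (aluthge_transform T)) x = (R \<circ> (\<lambda>x. U x - L x) \<circ> R) x" for x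
      unfolding D adjD by (simp add: RR U_def L_def R.diff)
    then have "hyponormal (aluthge_transform T) \<longleftrightarrow> positive_op (R \<circ> (\<lambda>x. U x - L x) \<circ> R)"
      unfolding hyponormal_def op_le_def by presburger
    also have "\<dots> \<longleftrightarrow> L \<preceq> U"
      unfolding op_le_def
    proof (rule positive_op_compression_iff[OF R(1)])
      show "bounded_clinear (\<lambda>x. U x - L x)"
        using L U by (intro bounded_clinear_diff positive_opD)
      show "inner (U x - L x) y = inner x (U y - L y)" for x y
        by (simp add: inner_simps positive_opD(2)[OF L] positive_opD(2)[OF U])
    next
      fix x assume "R x = 0"
      then have "P x = 0" using RR[of x] R.zero by simp
      moreover have "ker P = ker V" "ker P = ker (adj T)"
        using assms(2,3) ker_abs_op[OF assms(1)] by (auto simp: polar_decomposition_def P_def)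
      ultimately have "V x = 0" "adj T x = 0" by blast+
      moreover have "adj T = P \<circ> W"
        using adj_compose[OF V positive_opD(1)[OF P]] T adj_positive[OF P] by (simp add: W_def)
      ultimately have "V x = 0" "P (W x) = 0" by simp_all
      then show "U x - L x = 0"
        by (simp add: U_def L_def P.zero V.zero W.zero)
    qed
    finally show ?thesis .
  qed
  have "L \<preceq> U" if "L \<preceq> P" "P \<preceq> U"
    using positive_op_add[OF that[unfolded op_le_def]] by (simp add: op_le_def)
  then show ?thesis
    using LP_iff_PU 1 3 4 5 unfolding L_def U_def W_def P_def by blast
qed

end
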